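(* Let $\Pi$ be a non-negative orthogonally invariant function on the set of real symmetric positive definite matrices of order $q$, let $\eta\ge 0$, and let $S_n$ be the sample covariance matrix of a sample in $\mathbb{R}^q$. Express $S_n=P_nD_nP_n^{\mathrm T}$ with $P_n$ an orthogonal matrix of order $q$ and $D_n=\mathrm{diag}\{d_1,\ldots,d_q\}$, $d_1\ge\cdots\ge d_q$. Then for every $\Sigma>0$ with eigenvalues $\lambda_1\ge\cdots\ge\lambda_q>0$, $$L(\Sigma;S_n,\eta)\ \ge\ L(P_n\Lambda P_n^{\mathrm T};S_n,\eta),$$ where $\Lambda=\mathrm{diag}\{\lambda_1,\ldots,\lambda_q\}$.
   Context: $\Sigma>0$ means $\Sigma$ is a real symmetric positive definite matrix of order $q$. For a sample $x_1,\ldots,x_n\in\mathbb{R}^q$, the sample covariance matrix is $S_n=n^{-1}\sum_{i=1}^n(x_i-\bar x)(x_i-\bar x)^{\mathrm T}$, a symmetric positive semidefinite matrix. The penalized loss function is $L(\Sigma;S_n,\eta)=\mathrm{tr}(\Sigma^{-1}S_n)+\log\det\Sigma+\eta\,\Pi(\Sigma)$. $\Pi$ is orthogonally invariant if $\Pi(\Sigma)=\Pi(H\Sigma H^{\mathrm T})$ for every orthogonal matrix $H$ of order $q$ and every $\Sigma>0$. *)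

theory Defs
  imports "HOL-Analysis.Analysis" "HOL-Computational_Algebra.Polynomial"
begin

text \<open>
  Matrices of order \<open>q\<close> have type \<^typ>\<open>real ^ 'q ^ 'q\<close> with \<open>'q\<close> a finite type. Where eigenvalues
  are listed in decreasing order, \<open>'q\<close> is also linearly ordered, so that it stands for the index
  set \<open>{1, \<dots>, q}\<close>.
\<close>

definition diag_matrix :: "('q \<Rightarrow> 'a::zero) \<Rightarrow> 'a ^ 'q ^ 'q" where
  "diag_matrix d = (\<chi> i j. if i = j then d i else 0)"

definition pos_def_matrix :: "real ^ 'q ^ 'q \<Rightarrow> bool" where
  "pos_def_matrix A \<longleftrightarrow> transpose A = A \<and> (\<forall>v. v \<noteq> 0 \<longrightarrow> v \<bullet> (A *v v) > 0)"

definition charpoly :: "real ^ 'q ^ 'q \<Rightarrow> real poly" where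
  "charpoly A = det (\<chi> i j. (if i = j then [:0, 1:] else 0) - [:A $ i $ j:])"

text \<open>
  The family \<open>l\<close> lists the eigenvalues of \<open>A\<close>, each repeated according to its algebraic
  multiplicity; all of them are real.
\<close>

definition eigenvalue_family :: "real ^ 'q ^ 'q \<Rightarrow> ('q \<Rightarrow> real) \<Rightarrow> bool" where
  "eigenvalue_family A l \<longleftrightarrow> charpoly A = (\<Prod>i\<in>UNIV. [:- l i, 1:])"

definition sample_mean :: "nat \<Rightarrow> (nat \<Rightarrow> real ^ 'q) \<Rightarrow> real ^ 'q" where
  "sample_mean n x = (1 / real n) *\<^sub>R (\<Sum>i=1..n. x i)"

text \<open>
  The product \<open>u u\<^sup>T\<close> of a column vector and its transpose is formed with \<open>q \<times> 1\<close> and \<open>1 \<times> q\<close>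
  matrices. The divisor is \<open>n\<close>, not \<open>n - 1\<close>.
\<close>

definition sample_cov :: "nat \<Rightarrow> (nat \<Rightarrow> real ^ 'q) \<Rightarrow> real ^ 'q ^ 'q" where
  "sample_cov n x = (1 / real n) *\<^sub>R
     (\<Sum>i=1..n. (columnvector (x i - sample_mean n x) :: real ^ 1 ^ 'q)
                   ** transpose (columnvector (x i - sample_mean n x)))"

definition penalized_loss ::
  "(real ^ 'q ^ 'q \<Rightarrow> real) \<Rightarrow> real ^ 'q ^ 'q \<Rightarrow> real ^ 'q ^ 'q \<Rightarrow> real \<Rightarrow> real" where
  "penalized_loss pen A S \<eta> = trace (matrix_inv A ** S) + ln (det A) + \<eta> * pen A"

text \<open>
  A penalty is a total function on matrices, but only its values at positive definite matrices
  are constrained.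
\<close>

definition nonneg_penalty :: "(real ^ 'q ^ 'q \<Rightarrow> real) \<Rightarrow> bool" where
  "nonneg_penalty pen \<longleftrightarrow> (\<forall>A. pos_def_matrix A \<longrightarrow> 0 \<le> pen A)"

definition orthogonally_invariant :: "(real ^ 'q ^ 'q \<Rightarrow> real) \<Rightarrow> bool" where
  "orthogonally_invariant pen \<longleftrightarrow>
     (\<forall>A H. pos_def_matrix A \<longrightarrow> orthogonal_matrix H \<longrightarrow> pen A = pen (H ** A ** transpose H))"

end

theory Submission
  imports Defs
begin

text \<open>
  Once an orthogonal diagonalization \<open>\<Sigma> = Q \<Lambda> Q\<^sup>T\<close> with the eigenvalues in the prescribed order is
  available, \<open>\<Sigma>\<close> and \<open>P \<Lambda> P\<^sup>T\<close> are orthogonally conjugate, so the determinant and the penalty do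
  not distinguish them and only the trace terms have to be compared. With \<open>R = Q\<^sup>T P\<close>, the trace of
  \<open>\<Sigma>\<^sup>-\<^sup>1 S\<^sub>n\<close> is the sum of \<open>(1/\<lambda> i) (d j) (R i j)\<^sup>2\<close> over all \<open>i\<close> and \<open>j\<close>
  (\<open>trace_conjugated_diag_matrices\<close>), and for \<open>P \<Lambda> P\<^sup>T\<close> the matrix \<open>R\<close> is replaced by the identity.
  The squared entries of \<open>R\<close> form a doubly stochastic matrix, and \<open>1/\<lambda>\<close> and \<open>d\<close> are oppositely
  ordered, so by the rearrangement inequality for doubly stochastic weights
  (\<open>doubly_stochastic_rearrangement\<close>) the identity gives the smallest value.

  The diagonalization is the spectral theorem (\<open>symmetric_matrix_diagonalization\<close>); its diagonal
  is then matched with the given list of eigenvalues by comparing the roots of two factorizations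
  of the characteristic polynomial (\<open>diagonalization_with_eigenvalue_family\<close>).
\<close>

section \<open>The spectral theorem\<close>

text \<open>
  A maximizer \<open>x\<close> of the quadratic form \<open>v \<bullet> f v\<close> on the unit sphere of \<open>S\<close>, with value \<open>m\<close>, is an
  eigenvector: \<open>m (v \<bullet> v) - v \<bullet> f v\<close> is non-negative on \<open>S\<close> and vanishes at \<open>x\<close>, so its polar form
  with \<open>x\<close>, which is \<open>y \<mapsto> (m x - f x) \<bullet> y\<close>, must vanish on \<open>S\<close>.
\<close>

lemma self_adjoint_eigenvector_in_subspace:
  fixes f :: "'a::euclidean_space \<Rightarrow> 'a"
  assumes lin: "linear f"
    and adj: "\<And>u v. f u \<bullet> v = u \<bullet> f v"
    and S: "subspace S" and inv: "\<And>v. v \<in> S \<Longrightarrow> f v \<in> S"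
    and z: "z \<in> S" "z \<noteq> 0"
  obtains x m where "x \<in> S" "norm x = 1" "f x = m *\<^sub>R x"
proof -
  let ?U = "S \<inter> sphere 0 1"
  have "compact ?U"
    using S by (simp add: closed_subspace closed_Int_compact)
  moreover have "z /\<^sub>R norm z \<in> ?U"
    using z S by (simp add: subspace_scale)
  hence "?U \<noteq> {}" by blast
  moreover have "continuous_on ?U (\<lambda>v. v \<bullet> f v)"
    using lin by (intro continuous_intros linear_continuous_on) (simp add: linear_conv_bounded_linear)
  ultimately obtain x where x: "x \<in> ?U" and max: "\<And>y. y \<in> ?U \<Longrightarrow> y \<bullet> f y \<le> x \<bullet> f x"
    using continuous_attains_sup by metis
  have xS: "x \<in> S" and nx: "norm x = 1" using x by auto
  define m where "m = x \<bullet> f x"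
  have nonneg: "v \<bullet> f v \<le> m * (v \<bullet> v)" if "v \<in> S" for v
  proof (cases "v = 0")
    case False
    have "v /\<^sub>R norm v \<in> ?U"
      using that False S by (simp add: subspace_scale)
    from max[OF this] have "(v \<bullet> f v) / (norm v)\<^sup>2 \<le> m"
      using lin by (simp add: m_def linear_scale power2_eq_square field_simps)
    thus ?thesis
      using False by (simp add: divide_le_eq dot_square_norm)
  qed (use lin in \<open>simp add: linear_0\<close>)
  define y where "y = m *\<^sub>R x - f x"
  have yS: "y \<in> S"
    unfolding y_def using S xS inv by (simp add: subspace_diff subspace_scale)
  \<comment> \<open>Non-negativity at \<open>x - t y\<close> reads \<open>2 t (y \<bullet> y) \<le> t\<^sup>2 c\<close>; for small \<open>t > 0\<close> this forces
    \<open>y \<bullet> y \<le> 0\<close>.\<close>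
  define c where "c = m * (y \<bullet> y) - y \<bullet> f y"
  have xx: "x \<bullet> x = 1" using nx by (simp add: norm_eq_1)
  have perturb: "2 * t * (y \<bullet> y) \<le> t\<^sup>2 * c" for t
  proof -
    have "x - t *\<^sub>R y \<in> S"
      using S xS yS by (simp add: subspace_diff subspace_scale)
    from nonneg[OF this]
    have le: "(x - t *\<^sub>R y) \<bullet> (f x - t *\<^sub>R f y) \<le> m * ((x - t *\<^sub>R y) \<bullet> (x - t *\<^sub>R y))"
      by (simp only: linear_diff[OF lin] linear_scale[OF lin])
    have form: "(x - t *\<^sub>R y) \<bullet> (f x - t *\<^sub>R f y) = m - 2 * t * (f x \<bullet> y) + t\<^sup>2 * (y \<bullet> f y)"
      using adj[of x y]
      by (simp add: m_def inner_diff_left inner_diff_right inner_commute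
          algebra_simps power2_eq_square)
    have sq: "(x - t *\<^sub>R y) \<bullet> (x - t *\<^sub>R y) = 1 - 2 * t * (x \<bullet> y) + t\<^sup>2 * (y \<bullet> y)"
      by (simp add: xx inner_diff_left inner_diff_right inner_commute
          algebra_simps power2_eq_square)
    have "2 * t * (m * (x \<bullet> y) - f x \<bullet> y) \<le> t\<^sup>2 * (m * (y \<bullet> y) - y \<bullet> f y)"
      using le unfolding form sq by (simp add: algebra_simps)
    moreover have "m * (x \<bullet> y) - f x \<bullet> y = y \<bullet> y"
      by (simp add: y_def inner_diff_left)
    ultimately show ?thesis
      by (simp add: c_def)
  qed
  have "y \<bullet> y = 0"
  proof (rule ccontr)
    assume "y \<bullet> y \<noteq> 0"
    hence pos: "y \<bullet> y > 0" by (simp add: inner_gt_zero_iff)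
    define t where "t = (y \<bullet> y) / (\<bar>c\<bar> + 1)"
    have t: "t > 0" unfolding t_def using pos by (intro divide_pos_pos) auto
    have "t * c \<le> t * (\<bar>c\<bar> + 1)" using t by (intro mult_left_mono) auto
    also have "\<dots> = y \<bullet> y" by (simp add: t_def)
    finally have "t * (t * c) \<le> t * (y \<bullet> y)" using t by simp
    moreover have "t * (y \<bullet> y) > 0" using t pos by simp
    ultimately show False
      using perturb[of t] by (simp add: power2_eq_square algebra_simps)
  qed
  hence "f x = m *\<^sub>R x" by (simp add: y_def)
  with xS nx that show thesis by blast
qed

text \<open>
  An orthonormal set of eigenvectors that is too small to span has a nonzero orthogonal
  complement, which a self-adjoint map preserves, so the set can be extended by one eigenvector.
\<close>

lemma self_adjoint_orthonormal_eigenvectors: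
  fixes f :: "'a::euclidean_space \<Rightarrow> 'a"
  assumes lin: "linear f"
    and adj: "\<And>u v. f u \<bullet> v = u \<bullet> f v"
    and "k \<le> DIM('a)"
  shows "\<exists>B. finite B \<and> card B = k \<and> pairwise orthogonal B \<and>
           (\<forall>b\<in>B. norm b = 1 \<and> (\<exists>m. f b = m *\<^sub>R b))"
  using \<open>k \<le> DIM('a)\<close>
proof (induction k)
  case 0
  show ?case by (rule exI[of _ "{}"]) simp
next
  case (Suc k)
  then obtain B where B: "finite B" "card B = k" "pairwise orthogonal B"
    and eig: "\<And>b. b \<in> B \<Longrightarrow> norm b = 1 \<and> (\<exists>m. f b = m *\<^sub>R b)"
    by auto
  have "dim B < DIM('a)"
    using dim_le_card'[OF B(1)] B(2) Suc.prems by simp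
  then obtain z where z: "z \<noteq> 0" "\<And>y. y \<in> span B \<Longrightarrow> orthogonal z y"
    using orthogonal_to_subspace_exists by metis
  let ?S = "{y. \<forall>b\<in>B. orthogonal b y}"
  have "f v \<in> ?S" if "v \<in> ?S" for v
  proof -
    have "b \<bullet> f v = 0" if b: "b \<in> B" for b
    proof -
      obtain m where "f b = m *\<^sub>R b" using eig[OF b] by blast
      with adj[of b v] \<open>v \<in> ?S\<close> b show ?thesis by (simp add: orthogonal_def)
    qed
    thus ?thesis by (simp add: orthogonal_def)
  qed
  moreover have "z \<in> ?S"
    using z by (auto simp: span_base orthogonal_commute)
  ultimately obtain x m where x: "x \<in> ?S" "norm x = 1" "f x = m *\<^sub>R x"
    using self_adjoint_eigenvector_in_subspace[OF lin adj subspace_orthogonal_to_vectors, of B z] z(1)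
    by blast
  have "x \<notin> B"
    using x by (auto simp: orthogonal_def norm_eq_1)
  moreover have "pairwise orthogonal (insert x B)"
    using B(3) x(1) by (auto simp: pairwise_insert orthogonal_commute)
  ultimately show ?case
    using B x eig by (intro exI[of _ "insert x B"]) auto
qed

lemma matrix_mult_diag_matrix_entry:
  fixes A :: "real ^ 'q ^ 'q"
  shows "(A ** diag_matrix m) $ i $ j = A $ i $ j * m j"
  by (simp add: matrix_matrix_mult_def diag_matrix_def if_distrib cong: if_cong)

lemma conjugated_diag_matrix_entry:
  fixes A :: "real ^ 'q ^ 'q"
  shows "(A ** diag_matrix m ** transpose A) $ i $ j = (\<Sum>k\<in>UNIV. A $ i $ k * m k * A $ j $ k)"
  by (simp add: matrix_matrix_mult_def[of "A ** diag_matrix m"]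
      matrix_mult_diag_matrix_entry transpose_def)

lemma symmetric_matrix_diagonalization:
  fixes A :: "real ^ 'q ^ 'q"
  assumes sym: "transpose A = A"
  obtains Q m where "orthogonal_matrix Q" "A = Q ** diag_matrix m ** transpose Q"
proof -
  have adj: "(A *v u) \<bullet> v = u \<bullet> (A *v v)" for u v
    using dot_lmul_matrix[of u A v] transpose_matrix_vector[of A u] by (simp add: sym)
  obtain B where B: "finite B" "card B = CARD('q)" "pairwise orthogonal B"
    and eig: "\<And>b. b \<in> B \<Longrightarrow> norm b = 1 \<and> (\<exists>m. A *v b = m *\<^sub>R b)"
    using self_adjoint_orthonormal_eigenvectors[OF matrix_vector_mul_linear adj, of "CARD('q)"]
    by auto
  obtain h where h: "bij_betw h (UNIV :: 'q set) B"
    using B finite_same_card_bij[of "UNIV :: 'q set" B] by auto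
  hence hB: "h i \<in> B" for i by (auto simp: bij_betw_def)
  have "\<forall>i. \<exists>m. A *v h i = m *\<^sub>R h i"
    using eig[OF hB] by blast
  then obtain m where m: "\<And>i. A *v h i = m i *\<^sub>R h i"
    by metis
  define Q :: "real ^ 'q ^ 'q" where "Q = (\<chi> i j. h j $ i)"
  have col: "column j Q = h j" for j by (simp add: Q_def column_def)
  have "orthogonal_matrix Q"
    unfolding orthogonal_matrix_orthonormal_columns col
  proof (intro conjI allI impI)
    show "norm (h i) = 1" for i using eig[OF hB] by blast
    show "orthogonal (h i) (h j)" if "i \<noteq> j" for i j
    proof -
      have "h i \<noteq> h j"
        using h that by (simp add: bij_betw_def inj_eq)
      thus ?thesis using pairwiseD[OF B(3) hB hB] by blast
    qed
  qed
  moreover have "A ** Q = Q ** diag_matrix m"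
  proof -
    have "(A ** Q) $ i $ j = (A *v h j) $ i" for i j
      by (simp add: matrix_matrix_mult_def matrix_vector_mult_def Q_def)
    thus ?thesis
      by (simp add: vec_eq_iff m matrix_mult_diag_matrix_entry Q_def)
  qed
  hence "Q ** diag_matrix m ** transpose Q = A ** (Q ** transpose Q)"
    by (simp add: matrix_mul_assoc)
  ultimately show thesis
    by (intro that) (auto simp: orthogonal_matrix_def)
qed

section \<open>Matching the diagonal with the eigenvalue list\<close>

text \<open>
  Evaluation at a point turns a determinant of polynomials into a real one, where conjugation by an
  orthogonal matrix can be cancelled. A real polynomial is recovered from its values.
\<close>

lemma poly_charpoly: "poly (charpoly A) t = det (mat t - A)"
  unfolding charpoly_def det_def poly_sum
  by (intro sum.cong refl)
    (auto simp: poly_prod mat_def intro!: prod.cong)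

lemma charpoly_orthogonal_conjugate_diag_matrix:
  fixes Q :: "real ^ 'q ^ 'q"
  assumes Q: "orthogonal_matrix Q"
  shows "charpoly (Q ** diag_matrix m ** transpose Q) = (\<Prod>i\<in>UNIV. [:- m i, 1:])"
proof -
  have QQ: "Q ** transpose Q = mat 1" "transpose Q ** Q = mat 1"
    using Q by (simp_all add: orthogonal_matrix_def)
  have "poly (charpoly (Q ** diag_matrix m ** transpose Q)) t
          = poly (\<Prod>i\<in>UNIV. [:- m i, 1:]) t" for t
  proof -
    have "(\<Sum>k\<in>UNIV. Q $ i $ k * Q $ j $ k) = (if i = j then 1 else 0)" for i j
      using arg_cong[OF QQ(1), of "\<lambda>M. M $ i $ j"]
      by (simp add: matrix_matrix_mult_def transpose_def mat_def)
    hence "(\<Sum>k\<in>UNIV. Q $ i $ k * t * Q $ j $ k) = (if i = j then t else 0)" for i j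
      by (simp add: mult.assoc mult.left_commute[of _ t] sum_distrib_left[symmetric])
    hence "mat t - Q ** diag_matrix m ** transpose Q
             = Q ** diag_matrix (\<lambda>i. t - m i) ** transpose Q"
      by (simp add: vec_eq_iff conjugated_diag_matrix_entry mat_def right_diff_distrib
          left_diff_distrib sum_subtractf)
    hence "poly (charpoly (Q ** diag_matrix m ** transpose Q)) t
             = det Q * det (transpose Q) * det (diag_matrix (\<lambda>i. t - m i) :: real ^ 'q ^ 'q)"
      by (simp add: poly_charpoly det_mul)
    also have "det Q * det (transpose Q) = 1"
      by (metis QQ(1) det_mul det_I)
    also have "det (diag_matrix (\<lambda>i. t - m i) :: real ^ 'q ^ 'q) = (\<Prod>i\<in>UNIV. t - m i)"
      by (subst det_diagonal) (auto simp: diag_matrix_def)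
    finally show ?thesis by (simp add: poly_prod)
  qed
  thus ?thesis by (simp add: poly_eq_poly_eq_iff[symmetric] fun_eq_iff)
qed

text \<open>
  Two monic factorizations of one polynomial into linear factors have the same multiset of roots,
  so the two lists of eigenvalues differ by a permutation, which is applied to the columns of the
  diagonalizing matrix.
\<close>

lemma diagonalization_with_eigenvalue_family:
  fixes A :: "real ^ 'q ^ 'q"
  assumes sym: "transpose A = A" and l: "eigenvalue_family A l"
  obtains Q where "orthogonal_matrix Q" "A = Q ** diag_matrix l ** transpose Q"
proof -
  obtain V m where V: "orthogonal_matrix V" and A: "A = V ** diag_matrix m ** transpose V"
    using symmetric_matrix_diagonalization[OF sym] .
  have roots: "proots (\<Prod>i\<in>UNIV. [:- f i, 1:]) = image_mset f (mset_set UNIV)"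
    for f :: "'q \<Rightarrow> real"
    by (subst proots_prod) (auto simp: sum_unfold_sum_mset)
  have "(\<Prod>i\<in>UNIV. [:- l i, 1:]) = (\<Prod>i\<in>UNIV. [:- m i, 1:])"
    using l charpoly_orthogonal_conjugate_diag_matrix[OF V, of m] A
    by (simp add: eigenvalue_family_def)
  hence "image_mset l (mset_set UNIV) = image_mset m (mset_set UNIV)"
    by (metis roots)
  then obtain p where p: "p permutes UNIV" and lp: "\<And>i. l i = m (p i)"
    using image_mset_eq_implies_permutes[of UNIV l m] by auto
  define Q :: "real ^ 'q ^ 'q" where "Q = (\<chi> i j. V $ i $ p j)"
  have bij: "bij p" using p by (rule permutes_bij)
  have "column j Q = column (p j) V" for j by (simp add: Q_def column_def)
  with V bij have "orthogonal_matrix Q"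
    by (simp add: orthogonal_matrix_orthonormal_columns bij_def inj_eq)
  moreover have "Q ** diag_matrix l ** transpose Q = V ** diag_matrix m ** transpose V"
  proof -
    have "(\<Sum>k\<in>UNIV. V $ i $ p k * m (p k) * V $ j $ p k)
            = (\<Sum>k\<in>UNIV. V $ i $ k * m k * V $ j $ k)" for i j
      by (rule sum.reindex_bij_betw[OF bij])
    thus ?thesis
      unfolding vec_eq_iff conjugated_diag_matrix_entry by (simp add: Q_def lp)
  qed
  ultimately show thesis
    using A that by simp
qed

lemma pos_def_diag_pos:
  fixes Q :: "real ^ 'q ^ 'q"
  assumes "pos_def_matrix (Q ** diag_matrix l ** transpose Q)" and Q: "orthogonal_matrix Q"
  shows "l i > 0"
proof -
  let ?v = "Q *v axis i 1"
  have QQ: "transpose Q ** Q = mat 1"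
    using Q by (simp add: orthogonal_matrix_def)
  have v: "transpose Q *v ?v = axis i 1"
    by (simp add: matrix_vector_mul_assoc QQ)
  hence "?v \<noteq> 0" by (metis axis_eq_0_iff matrix_vector_mult_0_right zero_neq_one)
  hence "0 < ?v \<bullet> ((Q ** diag_matrix l ** transpose Q) *v ?v)"
    using assms(1) by (simp add: pos_def_matrix_def)
  also have "\<dots> = ?v \<bullet> (Q *v (diag_matrix l *v axis i 1))"
    by (metis matrix_vector_mul_assoc v)
  also have "\<dots> = (transpose Q *v ?v) \<bullet> (diag_matrix l *v axis i 1)"
    by (simp add: dot_lmul_matrix[symmetric] transpose_matrix_vector)
  also have "\<dots> = axis i 1 \<bullet> (diag_matrix l *v axis i 1)"
    by (simp only: v)
  also have "\<dots> = l i"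
    by (simp add: matrix_vector_mul_component inner_axis' inner_axis diag_matrix_def)
  finally show ?thesis .
qed

section \<open>Rearrangement with doubly stochastic weights\<close>

text \<open>
  A dual certificate for the rearrangement inequality: \<open>v\<close> plays the part of \<open>\<integral> a db\<close>, which is
  concave as a function of \<open>b\<close> because \<open>a\<close> decreases as \<open>b\<close> grows, and \<open>a i\<close> is the slope of a
  line that supports it from above at \<open>b i\<close>.
\<close>

lemma supergradient_potential:
  fixes a b :: "'q::{finite,linorder} \<Rightarrow> real"
  assumes a: "antimono a" and b: "mono b"
  obtains v where "\<And>i j. v j - v i \<le> a i * (b j - b i)"
proof -
  have "\<exists>v :: 'q \<Rightarrow> real. \<forall>i\<in>A. \<forall>j\<in>A. v j - v i \<le> a i * (b j - b i)"
    if "finite A" for A :: "'q set"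
    using that
  proof (induction A rule: finite_linorder_max_induct)
    case empty
    show ?case by simp
  next
    case (insert m A)
    then obtain v :: "'q \<Rightarrow> real" where v: "\<And>i j. i \<in> A \<Longrightarrow> j \<in> A \<Longrightarrow> v j - v i \<le> a i * (b j - b i)"
      by auto
    show ?case
    proof (cases "A = {}")
      case False
      \<comment> \<open>The potential is continued as a linear function of \<open>b\<close> beyond the previous largest
        index. Any slope between \<open>a m\<close> and \<open>a p\<close> keeps it concave.\<close>
      define p where "p = Max A"
      have p: "p \<in> A" "\<And>i. i \<in> A \<Longrightarrow> i \<le> p"
        using False insert.hyps(1) by (auto simp: p_def)
      have pm: "p \<le> m" using p insert.hyps(2) by auto
      define w where "w = v(m := v p + a p * (b m - b p))"
      have wA: "w i = v i" if "i \<in> A" for i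
        using that insert.hyps(2) by (auto simp: w_def)
      have up: "w m - w i \<le> a i * (b m - b i)" if i: "i \<in> A" for i
      proof -
        have "a p * (b m - b p) \<le> a i * (b m - b p)"
          using a b p(2)[OF i] pm by (intro mult_right_mono) (auto dest: antimonoD monoD)
        with v[OF i p(1)] show ?thesis
          using wA[OF i] by (simp add: w_def algebra_simps)
      qed
      have down: "w i - w m \<le> a m * (b i - b m)" if i: "i \<in> A" for i
      proof -
        have "a p * (b i - b m) \<le> a m * (b i - b m)"
          using a b p(2)[OF i] pm
          by (intro mult_right_mono_neg) (auto dest: antimonoD intro: monoD)
        with v[OF p(1) i] show ?thesis
          using wA[OF i] by (simp add: w_def algebra_simps)
      qed
      show ?thesis
        using up down v wA by (intro exI[of _ w]) auto
    qed auto
  qed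
  from this[of UNIV] that show thesis by auto
qed

text \<open>
  The bound \<open>b j * a j - v j + v i \<le> b i * a j\<close> provided by the potential is averaged against the
  weights. Its left side splits into a function of \<open>j\<close> and a function of \<open>i\<close>, so only the column and
  row sums enter, and \<open>v\<close> cancels. This replaces a decomposition of the weights into
  permutation matrices.
\<close>

lemma doubly_stochastic_rearrangement:
  fixes a b :: "'q::{finite,linorder} \<Rightarrow> real" and W :: "'q \<Rightarrow> 'q \<Rightarrow> real"
  assumes a: "antimono a" and b: "mono b"
    and nonneg: "\<And>i j. W i j \<ge> 0"
    and row: "\<And>i. (\<Sum>j\<in>UNIV. W i j) = 1"
    and col: "\<And>j. (\<Sum>i\<in>UNIV. W i j) = 1"
  shows "(\<Sum>i\<in>UNIV. b i * a i) \<le> (\<Sum>i\<in>UNIV. \<Sum>j\<in>UNIV. b i * a j * W i j)"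
proof -
  obtain v where v: "\<And>i j. v j - v i \<le> a i * (b j - b i)"
    using supergradient_potential[OF a b] by blast
  have "(\<Sum>i\<in>UNIV. b i * a i) = (\<Sum>j\<in>UNIV. b j * a j - v j) + (\<Sum>i\<in>UNIV. v i)"
    by (simp add: sum_subtractf)
  also have "\<dots> = (\<Sum>j\<in>UNIV. \<Sum>i\<in>UNIV. (b j * a j - v j) * W i j)
                 + (\<Sum>i\<in>UNIV. \<Sum>j\<in>UNIV. v i * W i j)"
    by (simp add: sum_distrib_left[symmetric] row col)
  also have "\<dots> = (\<Sum>i\<in>UNIV. \<Sum>j\<in>UNIV. (b j * a j - v j) * W i j)
                 + (\<Sum>i\<in>UNIV. \<Sum>j\<in>UNIV. v i * W i j)"
    by (subst sum.swap) simp
  also have "\<dots> = (\<Sum>i\<in>UNIV. \<Sum>j\<in>UNIV. (b j * a j - v j + v i) * W i j)"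
    by (simp add: sum.distrib[symmetric] distrib_right)
  also have "\<dots> \<le> (\<Sum>i\<in>UNIV. \<Sum>j\<in>UNIV. b i * a j * W i j)"
  proof (intro sum_mono mult_right_mono nonneg)
    fix i j
    show "b j * a j - v j + v i \<le> b i * a j"
      using v[of i j] by (simp add: algebra_simps)
  qed
  finally show ?thesis .
qed

lemma orthogonal_matrix_squares_doubly_stochastic:
  fixes R :: "real ^ 'q ^ 'q"
  assumes "orthogonal_matrix R"
  shows "(\<Sum>j\<in>UNIV. (R $ i $ j)\<^sup>2) = 1" "(\<Sum>i\<in>UNIV. (R $ i $ j)\<^sup>2) = 1"
proof -
  have "R ** transpose R = mat 1" "transpose R ** R = mat 1"
    using assms by (simp_all add: orthogonal_matrix_def)
  hence "(R ** transpose R) $ i $ i = 1" "(transpose R ** R) $ j $ j = 1"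
    by (simp_all add: mat_def)
  thus "(\<Sum>j\<in>UNIV. (R $ i $ j)\<^sup>2) = 1" "(\<Sum>i\<in>UNIV. (R $ i $ j)\<^sup>2) = 1"
    by (simp_all add: matrix_matrix_mult_def transpose_def power2_eq_square)
qed

section \<open>The loss in terms of a diagonalization\<close>

lemma trace_conjugated_diag_matrices:
  fixes Q P :: "real ^ 'q ^ 'q"
  shows "trace ((Q ** diag_matrix b ** transpose Q) ** (P ** diag_matrix a ** transpose P))
           = (\<Sum>i\<in>UNIV. \<Sum>j\<in>UNIV. b i * a j * ((transpose Q ** P) $ i $ j)\<^sup>2)"
proof -
  let ?R = "transpose Q ** P"
  have R: "transpose ?R = transpose P ** Q"
    by (simp add: matrix_transpose_mul transpose_transpose)
  have "trace ((Q ** diag_matrix b ** transpose Q) ** (P ** diag_matrix a ** transpose P))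
          = trace (Q ** (diag_matrix b ** ?R ** diag_matrix a ** transpose P))"
    by (simp add: matrix_mul_assoc)
  also have "\<dots> = trace ((diag_matrix b ** ?R ** diag_matrix a ** transpose P) ** Q)"
    by (rule trace_mul_sym)
  also have "\<dots> = trace (diag_matrix b ** (?R ** diag_matrix a ** transpose ?R))"
    by (simp add: R matrix_mul_assoc)
  also have "\<dots> = trace ((?R ** diag_matrix a ** transpose ?R) ** diag_matrix b)"
    by (rule trace_mul_sym)
  also have "\<dots> = (\<Sum>i\<in>UNIV. (?R ** diag_matrix a ** transpose ?R) $ i $ i * b i)"
    by (simp add: trace_def matrix_mult_diag_matrix_entry)
  also have "\<dots> = (\<Sum>i\<in>UNIV. (\<Sum>j\<in>UNIV. ?R $ i $ j * a j * ?R $ i $ j) * b i)"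
    by (simp only: conjugated_diag_matrix_entry)
  also have "\<dots> = (\<Sum>i\<in>UNIV. \<Sum>j\<in>UNIV. b i * a j * (?R $ i $ j)\<^sup>2)"
    unfolding sum_distrib_right
    by (intro sum.cong refl) (simp add: power2_eq_square)
  finally show ?thesis .
qed

lemma matrix_inv_conjugated_diag_matrix:
  fixes Q :: "real ^ 'q ^ 'q"
  assumes Q: "orthogonal_matrix Q" and l: "\<And>i. l i \<noteq> 0"
  shows "matrix_inv (Q ** diag_matrix l ** transpose Q)
           = Q ** diag_matrix (\<lambda>i. 1 / l i) ** transpose Q"
proof -
  have inv: "(Q ** diag_matrix f ** transpose Q) ** (Q ** diag_matrix g ** transpose Q) = mat 1"
    if "\<And>i. f i * g i = 1" for f g
  proof -
    have "(Q ** diag_matrix f ** transpose Q) ** (Q ** diag_matrix g ** transpose Q)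
            = Q ** diag_matrix f ** (transpose Q ** Q) ** diag_matrix g ** transpose Q"
      by (simp add: matrix_mul_assoc)
    also have "\<dots> = Q ** (diag_matrix f ** diag_matrix g) ** transpose Q"
      using Q by (simp add: orthogonal_matrix_def matrix_mul_assoc)
    also have "diag_matrix f ** diag_matrix g = (mat 1 :: real ^ 'q ^ 'q)"
      unfolding vec_eq_iff matrix_mult_diag_matrix_entry
      using that by (auto simp: diag_matrix_def mat_def)
    finally show ?thesis
      using Q by (simp add: orthogonal_matrix_def)
  qed
  let ?A = "Q ** diag_matrix l ** transpose Q"
  let ?B = "Q ** diag_matrix (\<lambda>i. 1 / l i) ** transpose Q"
  have AB: "?A ** ?B = mat 1" "?B ** ?A = mat 1"
    using l by (auto intro!: inv)
  have "?A ** matrix_inv ?A = mat 1 \<and> matrix_inv ?A ** ?A = mat 1"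
    unfolding matrix_inv_def by (rule someI[of _ ?B]) (use AB in blast)
  thus ?thesis
    by (metis AB(2) matrix_mul_assoc matrix_mul_lid matrix_mul_rid)
qed

theorem theorem5p1:
  fixes pen :: "real ^ 'q::{finite,linorder} ^ 'q::{finite,linorder} \<Rightarrow> real"
    and \<eta> :: real
    and n :: nat
    and x :: "nat \<Rightarrow> real ^ 'q::{finite,linorder}"
    and P Sig :: "real ^ 'q::{finite,linorder} ^ 'q::{finite,linorder}"
    and d l :: "'q::{finite,linorder} \<Rightarrow> real"
  assumes "nonneg_penalty pen"
    and "orthogonally_invariant pen"
    and "\<eta> \<ge> 0"
    and "n \<ge> 1"
    and "orthogonal_matrix P"
    and "antimono d"
    and "sample_cov n x = P ** diag_matrix d ** transpose P"
    and "pos_def_matrix Sig"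
    and "eigenvalue_family Sig l"
    and "antimono l"
  shows "penalized_loss pen Sig (sample_cov n x) \<eta>
           \<ge> penalized_loss pen (P ** diag_matrix l ** transpose P) (sample_cov n x) \<eta>"
proof -
  note P = \<open>orthogonal_matrix P\<close> and S = \<open>sample_cov n x = _\<close> and pd = \<open>pos_def_matrix Sig\<close>
  obtain Q where Q: "orthogonal_matrix Q" and Sig: "Sig = Q ** diag_matrix l ** transpose Q"
    using diagonalization_with_eigenvalue_family[of Sig l] pd \<open>eigenvalue_family Sig l\<close>
    by (auto simp: pos_def_matrix_def)
  have pos: "l i > 0" for i
    using pos_def_diag_pos[OF _ Q] pd Sig by simp
  hence nz: "l i \<noteq> 0" for i by (metis less_irrefl)
  let ?T = "P ** diag_matrix l ** transpose P"
  let ?b = "\<lambda>i. 1 / l i"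

  have QQ: "transpose Q ** Q = mat 1"
    using Q by (simp add: orthogonal_matrix_def)
  define H where "H = P ** transpose Q"
  have H: "orthogonal_matrix H"
    unfolding H_def using P Q by (intro orthogonal_matrix_mul) simp_all
  have T: "?T = H ** Sig ** transpose H"
  proof -
    have "H ** Sig ** transpose H
            = P ** (transpose Q ** Q) ** diag_matrix l ** (transpose Q ** Q) ** transpose P"
      by (simp add: H_def Sig matrix_transpose_mul matrix_mul_assoc)
    thus ?thesis by (simp add: QQ)
  qed
  have pen: "pen ?T = pen Sig"
    using \<open>orthogonally_invariant pen\<close> pd H T unfolding orthogonally_invariant_def by metis
  have "det H * det (transpose H) = 1"
    using H by (metis det_I det_mul orthogonal_matrix_def)
  hence det: "det ?T = det Sig"
    by (simp add: T det_mul)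

  have "mono ?b"
    using \<open>antimono l\<close> pos by (auto intro!: monoI divide_left_mono dest: antimonoD)
  have "transpose P ** P = mat 1"
    using P by (simp add: orthogonal_matrix_def)
  hence "trace (matrix_inv ?T ** sample_cov n x)
           = (\<Sum>i\<in>UNIV. \<Sum>j\<in>UNIV. ?b i * d j *
               ((mat 1 :: real ^ 'q::{finite,linorder} ^ 'q::{finite,linorder}) $ i $ j)\<^sup>2)"
    by (simp only: S matrix_inv_conjugated_diag_matrix[OF P nz] trace_conjugated_diag_matrices)
  also have "\<dots> = (\<Sum>i\<in>UNIV. ?b i * d i)"
    by (simp add: mat_def if_distrib if_distribR cong: if_cong)
  also have "\<dots> \<le> (\<Sum>i\<in>UNIV. \<Sum>j\<in>UNIV. ?b i * d j * ((transpose Q ** P) $ i $ j)\<^sup>2)"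
    using orthogonal_matrix_squares_doubly_stochastic[OF orthogonal_matrix_mul[of "transpose Q" P]] P Q
    by (intro doubly_stochastic_rearrangement \<open>antimono d\<close> \<open>mono ?b\<close>) auto
  also have "\<dots> = trace (matrix_inv Sig ** sample_cov n x)"
    by (simp only: S Sig matrix_inv_conjugated_diag_matrix[OF Q nz] trace_conjugated_diag_matrices)
  finally show ?thesis
    by (simp add: penalized_loss_def pen det)
qed

end
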